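(* Let $G$ be a Lie group, $h>0$, and let $\varphi:G^{s+1}\to C^2([0,h],G)$, $(g^0,\dots,g^s)\mapsto\varphi(g^\nu;\cdot)$, be an interpolatory function. Let $b_1,\dots,b_s$ be quadrature weights and $c_1,\dots,c_s\in[0,1]$ quadrature points. If $\varphi$ is $G$-equivariant and the Lagrangian $L:TG\to\mathbb{R}$ is $G$-invariant, then the discrete Lagrangian $L_d:G\times G\to\mathbb{R}$ given by $$L_d(g_0,g_1)=\operatorname*{ext}_{\substack{g^\nu\in G;\\ g^0=g_0;\ g^s=g_1}} h\sum_{i=1}^s b_i\,L\big(T\varphi(g^\nu;c_ih)\big)$$ is $G$-invariant, i.e. $L_d(gg_0,gg_1)=L_d(g_0,g_1)$ for all $g,g_0,g_1\in G$.
   Context: Here $\varphi(g^\nu;t)$ abbreviates $\varphi(g^0,\dots,g^s)(t)$, and $g^\nu$ abbreviates the tuple $(g^0,\dots,g^s)$ of internal points parameterizing the curve. $T\varphi(g^\nu;t)\in TG$ denotes the point of the tangent bundle consisting of $\varphi(g^\nu;t)$ together with its time derivative $\frac{d}{dt}\varphi(g^\nu;t)$. $\varphi$ is $G$-equivariant if $\varphi(gg^\nu;t)=g\,\varphi(g^\nu;t)$ for all $g\in G$, all $(g^0,\dots,g^s)\in G^{s+1}$ and all $t\in[0,h]$, where $gg^\nu=(gg^0,\dots,gg^s)$. $L$ is $G$-invariant if $L(TL_g\cdot w)=L(w)$ for all $g\in G$, $w\in TG$, where $L_g:G\to G$ is left translation by $g$ and $TL_g$ is its tangent map. $\operatorname{ext}$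 denotes the extremal (stationary) value of the expression over the free variables $g^1,\dots,g^{s-1}$, with $g^0=g_0$ and $g^s=g_1$ held fixed; this value is taken to be well defined, as is implicit in the definition of $L_d$. *)

theory Defs
  imports "HOL-Analysis.Analysis"
begin

text \<open>
  Continuous differentiability of finite order on subsets of normed spaces. The derivative is taken
  within the set, so that the notion also covers curves on a closed interval. The maps
  \<open>\<lambda>x. f' x v\<close> determine the derivative as a map into the space of linear maps
  only for a finite-dimensional domain, which is the case in all uses below.
\<close>

primrec Ck_on :: "nat \<Rightarrow> 'a::real_normed_vector set \<Rightarrow> ('a \<Rightarrow> 'b::real_normed_vector) \<Rightarrow> bool" where
  "Ck_on 0 S f \<longleftrightarrow> continuous_on S f"
| "Ck_on (Suc k) S f \<longleftrightarrow>
     (\<exists>f'. (\<forall>x\<in>S. (f has_derivative f' x) (at x within S)) \<and> (\<forall>v. Ck_on k S (\<lambda>x. f' x v)))"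

definition smooth_on :: "'a::real_normed_vector set \<Rightarrow> ('a \<Rightarrow> 'b::real_normed_vector) \<Rightarrow> bool" where
  "smooth_on S f \<longleftrightarrow> (\<forall>k. Ck_on k S f)"


text \<open>
  A chart is a pair of its domain and its coordinate map; the values of the map outside of the domain
  are irrelevant. The model space \<open>'e\<close> is a finite-dimensional inner product space; class
  \<open>euclidean_space\<close> is not used because it excludes dimension 0.
\<close>

type_synonym ('m, 'e) chart = "'m set \<times> ('m \<Rightarrow> 'e)"

definition is_chart :: "('m::topological_space, 'e::real_inner) chart \<Rightarrow> bool" where
  "is_chart = (\<lambda>(U, \<psi>). open U \<and> open (\<psi> ` U) \<and> homeomorphism U (\<psi> ` U) \<psi> (inv_into U \<psi>))"

definition smooth_atlas :: "('m::topological_space, 'e::real_inner) chart set \<Rightarrow> bool" where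
  "smooth_atlas A \<longleftrightarrow>
     (\<exists>B :: 'e set. finite B \<and> span B = UNIV) \<and>
     (\<forall>c\<in>A. is_chart c) \<and>
     (\<Union>(U, \<psi>)\<in>A. U) = UNIV \<and>
     (\<forall>(U, \<psi>)\<in>A. \<forall>(V, \<theta>)\<in>A. smooth_on (\<psi> ` (U \<inter> V)) (\<theta> \<circ> inv_into U \<psi>))"

definition product_atlas ::
  "('m, 'e) chart set \<Rightarrow> ('n, 'f) chart set \<Rightarrow> ('m \<times> 'n, 'e \<times> 'f) chart set" where
  "product_atlas A B = {(U \<times> V, map_prod \<psi> \<theta>) | U \<psi> V \<theta>. (U, \<psi>) \<in> A \<and> (V, \<theta>) \<in> B}"

definition smooth_map ::
  "('m::topological_space, 'e::real_inner) chart set \<Rightarrow>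
   ('n::topological_space, 'f::real_inner) chart set \<Rightarrow> ('m \<Rightarrow> 'n) \<Rightarrow> bool" where
  "smooth_map A B f \<longleftrightarrow>
     continuous_on UNIV f \<and>
     (\<forall>(U, \<psi>)\<in>A. \<forall>(V, \<theta>)\<in>B. smooth_on (\<psi> ` (U \<inter> f -` V)) (\<theta> \<circ> f \<circ> inv_into U \<psi>))"

definition smooth_functions ::
  "('m::topological_space, 'e::real_inner) chart set \<Rightarrow> ('m \<Rightarrow> real) set" where
  "smooth_functions A = {u. smooth_map A {(UNIV, id)} u}"

definition C2_curve ::
  "('m::topological_space, 'e::real_inner) chart set \<Rightarrow> real \<Rightarrow> (real \<Rightarrow> 'm) \<Rightarrow> bool" where
  "C2_curve A h \<gamma> \<longleftrightarrow>
     continuous_on {0..h} \<gamma> \<and>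
     (\<forall>(U, \<psi>)\<in>A. Ck_on 2 ({0..h} \<inter> \<gamma> -` U) (\<psi> \<circ> \<gamma>))"


text \<open>
  The whole type \<open>'g\<close> carries the group, and the manifold topology is that of the type.
  The locale \<open>group\<close> is the one of Main.
\<close>

locale lie_group =
  group gmult gone ginv
  for gmult :: "'g::{t2_space, second_countable_topology} \<Rightarrow> 'g \<Rightarrow> 'g"
    and gone :: 'g
    and ginv :: "'g \<Rightarrow> 'g" +
  fixes A :: "('g, 'e::real_inner) chart set"
  assumes atlas: "smooth_atlas A"
    and smooth_mult: "smooth_map (product_atlas A A) A (\<lambda>(x, y). gmult x y)"
    and smooth_inv: "smooth_map A A ginv"


text \<open>
  Tangent vectors are derivations of the algebra of smooth functions at a point, made extensional
  (\<open>undefined\<close> on non-smooth functions) so that equality is the intended one.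
  The base point is kept as first component.
\<close>

type_synonym 'm tangent = "'m \<times> (('m \<Rightarrow> real) \<Rightarrow> real)"

definition tangent_bundle ::
  "('m::topological_space, 'e::real_inner) chart set \<Rightarrow> 'm tangent set" where
  "tangent_bundle A = {(p, D). D \<in> extensional (smooth_functions A) \<and>
     (\<forall>u\<in>smooth_functions A. \<forall>v\<in>smooth_functions A. D (\<lambda>x. u x + v x) = D u + D v) \<and>
     (\<forall>r. \<forall>u\<in>smooth_functions A. D (\<lambda>x. r * u x) = r * D u) \<and>
     (\<forall>u\<in>smooth_functions A. \<forall>v\<in>smooth_functions A.
        D (\<lambda>x. u x * v x) = u p * D v + v p * D u)}"

definition tangent_map ::
  "('m::topological_space, 'e::real_inner) chart set \<Rightarrow>
   ('n::topological_space, 'f::real_inner) chart set \<Rightarrow> ('m \<Rightarrow> 'n) \<Rightarrow> 'm tangent \<Rightarrow> 'n tangent" where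
  "tangent_map A B f = (\<lambda>(p, D). (f p, \<lambda>u\<in>smooth_functions B. D (u \<circ> f)))"

text \<open>
  The point of a curve on \<open>[0,h]\<close> together with its time derivative, which is
  one-sided at the end points.
\<close>

definition tangent_lift ::
  "('m::topological_space, 'e::real_inner) chart set \<Rightarrow> real \<Rightarrow> (real \<Rightarrow> 'm) \<Rightarrow> real \<Rightarrow> 'm tangent" where
  "tangent_lift A h \<gamma> t =
     (\<gamma> t, \<lambda>u\<in>smooth_functions A. vector_derivative (u \<circ> \<gamma>) (at t within {0..h}))"

definition invariant_lagrangian ::
  "('g \<Rightarrow> 'g \<Rightarrow> 'g) \<Rightarrow> ('g::topological_space, 'e::real_inner) chart set \<Rightarrow>
   ('g tangent \<Rightarrow> real) \<Rightarrow> bool" where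
  "invariant_lagrangian gmult A L \<longleftrightarrow>
     (\<forall>g. \<forall>w\<in>tangent_bundle A. L (tangent_map A A (gmult g) w) = L w)"


text \<open>Tuples \<open>(g\<^sup>0, \<dots>, g\<^sup>s)\<close> are extensional functions on \<open>{0..s}\<close>.\<close>

abbreviation tuples :: "nat \<Rightarrow> (nat \<Rightarrow> 'g) set" where
  "tuples s \<equiv> {0..s} \<rightarrow>\<^sub>E UNIV"

definition interpolatory ::
  "('g::topological_space, 'e::real_inner) chart set \<Rightarrow> nat \<Rightarrow> real \<Rightarrow>
   ((nat \<Rightarrow> 'g) \<Rightarrow> real \<Rightarrow> 'g) \<Rightarrow> bool" where
  "interpolatory A s h \<phi> \<longleftrightarrow>
     (\<forall>x\<in>tuples s. C2_curve A h (\<phi> x)) \<and>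
     (\<exists>d :: nat \<Rightarrow> real. d 0 = 0 \<and> d s = 1 \<and> strict_mono_on {0..s} d \<and>
        (\<forall>x\<in>tuples s. \<forall>\<nu>\<in>{0..s}. \<phi> x (d \<nu> * h) = x \<nu>))"

definition equivariant ::
  "('g \<Rightarrow> 'g \<Rightarrow> 'g) \<Rightarrow> nat \<Rightarrow> real \<Rightarrow> ((nat \<Rightarrow> 'g) \<Rightarrow> real \<Rightarrow> 'g) \<Rightarrow> bool" where
  "equivariant gmult s h \<phi> \<longleftrightarrow>
     (\<forall>g. \<forall>x\<in>tuples s. \<forall>t\<in>{0..h}. \<phi> (\<lambda>\<nu>\<in>{0..s}. gmult g (x \<nu>)) t = gmult g (\<phi> x t))"

text \<open>
  \<open>F\<close>, regarded as a function on the product manifold of the variables with index in the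
  finite set \<open>I\<close> (all other variables being held at their values in \<open>x\<close>),
  is differentiable at \<open>x\<close> with vanishing differential: in coordinates around \<open>x\<close>,
  \<open>F y - F x\<close> is little-o of the (summed) distance of \<open>y\<close> from \<open>x\<close>.
  The library derivative is not applicable because the number of variables is a natural number.
\<close>

definition stationary_at ::
  "('m::topological_space, 'e::real_inner) chart set \<Rightarrow> nat set \<Rightarrow>
   ((nat \<Rightarrow> 'm) \<Rightarrow> real) \<Rightarrow> (nat \<Rightarrow> 'm) \<Rightarrow> bool" where
  "stationary_at A I F x \<longleftrightarrow>
     (\<forall>U \<psi>. (\<forall>i\<in>I. (U i, \<psi> i) \<in> A \<and> x i \<in> U i) \<longrightarrow>
       (\<forall>\<epsilon>>0. \<exists>\<delta>>0. \<forall>y.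
          (\<forall>i\<in>I. y i \<in> U i) \<and> (\<forall>i. i \<notin> I \<longrightarrow> y i = x i) \<and>
          (\<Sum>i\<in>I. norm (\<psi> i (y i) - \<psi> i (x i))) < \<delta> \<longrightarrow>
          \<bar>F y - F x\<bar> \<le> \<epsilon> * (\<Sum>i\<in>I. norm (\<psi> i (y i) - \<psi> i (x i)))))"

definition stationary_values ::
  "('m::topological_space, 'e::real_inner) chart set \<Rightarrow> nat \<Rightarrow>
   ((nat \<Rightarrow> 'm) \<Rightarrow> real) \<Rightarrow> 'm \<Rightarrow> 'm \<Rightarrow> real set" where
  "stationary_values A s F g0 g1 =
     F ` {x \<in> tuples s. x 0 = g0 \<and> x s = g1 \<and> stationary_at A {1..<s} F x}"

definition discrete_action ::
  "('g::topological_space, 'e::real_inner) chart set \<Rightarrow> nat \<Rightarrow> real \<Rightarrow> (nat \<Rightarrow> real) \<Rightarrow> (nat \<Rightarrow> real) \<Rightarrow>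
   ((nat \<Rightarrow> 'g) \<Rightarrow> real \<Rightarrow> 'g) \<Rightarrow> ('g tangent \<Rightarrow> real) \<Rightarrow> (nat \<Rightarrow> 'g) \<Rightarrow> real" where
  "discrete_action A s h b c \<phi> L x =
     h * (\<Sum>i=1..s. b i * L (tangent_lift A h (\<phi> x) (c i * h)))"

text \<open>
  There may be several stationary points, but they must all give the same value for the discrete
  Lagrangian to be well defined.
\<close>

definition ext_well_defined ::
  "('g::topological_space, 'e::real_inner) chart set \<Rightarrow> nat \<Rightarrow> real \<Rightarrow> (nat \<Rightarrow> real) \<Rightarrow> (nat \<Rightarrow> real) \<Rightarrow>
   ((nat \<Rightarrow> 'g) \<Rightarrow> real \<Rightarrow> 'g) \<Rightarrow> ('g tangent \<Rightarrow> real) \<Rightarrow> bool" where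
  "ext_well_defined A s h b c \<phi> L \<longleftrightarrow>
     (\<forall>g0 g1. is_singleton (stationary_values A s (discrete_action A s h b c \<phi> L) g0 g1))"

definition discrete_lagrangian ::
  "('g::topological_space, 'e::real_inner) chart set \<Rightarrow> nat \<Rightarrow> real \<Rightarrow> (nat \<Rightarrow> real) \<Rightarrow> (nat \<Rightarrow> real) \<Rightarrow>
   ((nat \<Rightarrow> 'g) \<Rightarrow> real \<Rightarrow> 'g) \<Rightarrow> ('g tangent \<Rightarrow> real) \<Rightarrow> 'g \<Rightarrow> 'g \<Rightarrow> real" where
  "discrete_lagrangian A s h b c \<phi> L g0 g1 =
     the_elem (stationary_values A s (discrete_action A s h b c \<phi> L) g0 g1)"

end

theory Submission
  imports Defs
begin

text \<open>
  By equivariance the tangent lift of the curve through the translated tuple is the image of the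
  original lift under the tangent map of the left translation, so the discrete action is invariant
  under simultaneous translation of all points. Left translations are diffeomorphisms, hence locally
  Lipschitz in charts, so they carry stationary points to stationary points. Each stationary value
  for \<open>(g0, g1)\<close> is thus one for the translated end points, and both sets of values are singletons.
\<close>

section \<open>Orthogonal expansions in finite-dimensional inner product spaces\<close>

text \<open>The residual \<open>w\<close> is orthogonal to every element of \<open>C\<close>, hence
  to the whole span, hence to itself, so it vanishes.\<close>

lemma orthogonal_expansion:
  fixes C :: "'a::real_inner set"
  assumes "finite C" "pairwise orthogonal C" "span C = UNIV"
  shows "v = (\<Sum>b\<in>C. (v \<bullet> b / (b \<bullet> b)) *\<^sub>R b)"
proof -
  define w where "w = v - (\<Sum>b\<in>C. (v \<bullet> b / (b \<bullet> b)) *\<^sub>R b)"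
  have "orthogonal w b" if "b \<in> C" for b
  proof -
    \<comment> \<open>The set \<open>C\<close> may contain 0: for \<open>a = b = 0\<close> the
      summand is 0 because of the factor \<open>a\<close>, and \<open>v \<bullet> b\<close> is 0 as
      well.\<close>
    have "(\<Sum>a\<in>C. (v \<bullet> a / (a \<bullet> a)) *\<^sub>R a) \<bullet> b = (\<Sum>a\<in>C. if a = b then v \<bullet> b else 0)"
      unfolding inner_sum_left using assms(2) that
      by (intro sum.cong) (auto simp: pairwise_def orthogonal_def)
    then show ?thesis
      using assms(1) that by (simp add: w_def orthogonal_def inner_diff_left)
  qed
  then have "orthogonal w w"
    using orthogonal_to_span[of w C w] assms(3) by (auto simp: orthogonal_commute)
  then show ?thesis
    by (simp add: w_def orthogonal_def)
qed

text \<open>Gram-Schmidt turns the finite spanning set supplied by an atlas into an orthogonal one,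
  which makes explicit coordinates available without class \<open>euclidean_space\<close>.\<close>

lemma finite_orthogonal_basis:
  fixes B :: "'a::real_inner set"
  assumes "finite B" "span B = UNIV"
  obtains C :: "'a set" where "finite C"
    and "\<forall>v. v = (\<Sum>b\<in>C. (v \<bullet> b / (b \<bullet> b)) *\<^sub>R b)"
  using basis_orthogonal[OF assms(1)] assms(2) orthogonal_expansion by metis

section \<open>Calculus of maps of class \<open>Ck_on\<close>\<close>

lemma Ck_on_cong:
  assumes "Ck_on k S f" "\<And>x. x \<in> S \<Longrightarrow> f x = g x"
  shows "Ck_on k S g"
proof (cases k)
  case 0
  then show ?thesis
    using assms continuous_on_cong[of S S f g] by simp
next
  case (Suc n)
  obtain f' where f': "\<forall>x\<in>S. (f has_derivative f' x) (at x within S)"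
    "\<forall>v. Ck_on n S (\<lambda>x. f' x v)" using assms(1) Suc by auto
  have "(g has_derivative f' x) (at x within S)" if "x \<in> S" for x
    using that assms(2) f'(1) has_derivative_transform[of x S g f] by auto
  with f'(2) Suc show ?thesis by auto
qed

lemma Ck_on_subset: "Ck_on k S f \<Longrightarrow> T \<subseteq> S \<Longrightarrow> Ck_on k T f"
proof (induction k arbitrary: f)
  case 0
  then show ?case by (auto intro: continuous_on_subset)
next
  case (Suc k)
  then show ?case
    by simp (meson has_derivative_subset subsetD)
qed

lemma Ck_on_Suc_imp: "Ck_on (Suc k) S f \<Longrightarrow> Ck_on k S f"
proof (induction k arbitrary: f)
  case 0
  then show ?case
    by (auto simp: continuous_on_eq_continuous_within dest: has_derivative_continuous)
next
  case (Suc k)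
  then show ?case
    by (metis Ck_on.simps(2))
qed

lemma Ck_on_const [simp]: "Ck_on k S (\<lambda>x. a)"
proof (induction k arbitrary: a)
  case (Suc k)
  have "\<forall>x\<in>S. ((\<lambda>x. a) has_derivative (\<lambda>h. 0)) (at x within S)"
    by simp
  with Suc[of 0] show ?case
    unfolding Ck_on.simps by (intro exI[of _ "\<lambda>x h. 0"]) blast
qed simp

lemma Ck_on_bounded_linear:
  assumes "bounded_linear l"
  shows "Ck_on k S f \<Longrightarrow> Ck_on k S (\<lambda>x. l (f x))"
proof (induction k arbitrary: f)
  case 0
  then show ?case by (simp add: bounded_linear.continuous_on[OF assms])
next
  case (Suc k)
  then obtain f' where f': "\<forall>x\<in>S. (f has_derivative f' x) (at x within S)"
    "\<forall>v. Ck_on k S (\<lambda>x. f' x v)" by auto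
  then show ?case
    using Suc.IH
    by (auto intro!: exI[of _ "\<lambda>x v. l (f' x v)"] bounded_linear.has_derivative[OF assms])
qed

lemma Ck_on_add: "Ck_on k S f \<Longrightarrow> Ck_on k S g \<Longrightarrow> Ck_on k S (\<lambda>x. f x + g x)"
proof (induction k arbitrary: f g)
  case 0
  then show ?case by (simp add: continuous_on_add)
next
  case (Suc k)
  then obtain f' g' where "\<forall>x\<in>S. (f has_derivative f' x) (at x within S)"
    "\<forall>v. Ck_on k S (\<lambda>x. f' x v)" "\<forall>x\<in>S. (g has_derivative g' x) (at x within S)"
    "\<forall>v. Ck_on k S (\<lambda>x. g' x v)" by auto
  then show ?case
    using Suc.IH by (auto intro!: exI[of _ "\<lambda>x v. f' x v + g' x v"] has_derivative_add)
qed

lemma Ck_on_sum: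
  "(\<And>i. i \<in> I \<Longrightarrow> Ck_on k S (f i)) \<Longrightarrow> Ck_on k S (\<lambda>x. \<Sum>i\<in>I. f i x)"
  by (induction I rule: infinite_finite_induct) (auto intro: Ck_on_add)

lemma Ck_on_scaleR:
  "Ck_on k S f \<Longrightarrow> Ck_on k S g \<Longrightarrow> Ck_on k S (\<lambda>x. f x *\<^sub>R g x)"
proof (induction k arbitrary: f g)
  case 0
  then show ?case by (simp add: continuous_on_scaleR)
next
  case (Suc k)
  obtain f' where f': "\<forall>x\<in>S. (f has_derivative f' x) (at x within S)"
    "\<forall>v. Ck_on k S (\<lambda>x. f' x v)" using Suc.prems by auto
  obtain g' where g': "\<forall>x\<in>S. (g has_derivative g' x) (at x within S)"
    "\<forall>v. Ck_on k S (\<lambda>x. g' x v)" using Suc.prems by auto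
  have "Ck_on k S (\<lambda>x. f x *\<^sub>R g' x v + f' x v *\<^sub>R g x)" for v
    using f' g' Suc.prems by (intro Ck_on_add Suc.IH) (auto intro: Ck_on_Suc_imp simp del: Ck_on.simps)
  with f' g' show ?case
    by (auto intro!: exI[of _ "\<lambda>x v. f x *\<^sub>R g' x v + f' x v *\<^sub>R g x"] has_derivative_scaleR)
qed

text \<open>
  The derivative is expanded in an orthogonal basis because \<open>Ck_on\<close> controls the derivative of
  \<open>g\<close> only in directions that do not depend on the point.
\<close>

lemma Ck_on_compose:
  fixes f :: "'a::real_normed_vector \<Rightarrow> 'b::real_inner"
  assumes "finite B" "span B = (UNIV :: 'b set)"
  shows "Ck_on k S f \<Longrightarrow> Ck_on k T g \<Longrightarrow> f ` S \<subseteq> T \<Longrightarrow> Ck_on k S (g \<circ> f)"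
proof (induction k arbitrary: g)
  case 0
  then show ?case by (metis Ck_on.simps(1) continuous_on_compose continuous_on_subset)
next
  case (Suc k)
  obtain C :: "'b set" where C: "finite C" "\<forall>v. v = (\<Sum>b\<in>C. (v \<bullet> b / (b \<bullet> b)) *\<^sub>R b)"
    using finite_orthogonal_basis[OF assms] .
  obtain f' where f': "\<forall>x\<in>S. (f has_derivative f' x) (at x within S)"
    "\<forall>v. Ck_on k S (\<lambda>x. f' x v)" using Suc.prems by auto
  obtain g' where g': "\<forall>y\<in>T. (g has_derivative g' y) (at y within T)"
    "\<forall>v. Ck_on k T (\<lambda>y. g' y v)" using Suc.prems by auto
  have der: "(g \<circ> f has_derivative (\<lambda>v. g' (f x) (f' x v))) (at x within S)" if "x \<in> S" for x
  proof -
    have "(g has_derivative g' (f x)) (at (f x) within f ` S)"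
      using g'(1) that Suc.prems(3) by (blast intro: has_derivative_subset)
    from has_derivative_in_compose[OF _ this] f'(1) that show ?thesis by (auto simp: o_def)
  qed
  have "Ck_on k S (\<lambda>x. g' (f x) (f' x v))" for v
  proof (rule Ck_on_cong)
    note lin = bounded_linear_compose[OF bounded_linear_divide bounded_linear_inner_left]
    \<comment> \<open>The direction \<open>b\<close> is fixed, so the induction hypothesis applies
      to \<open>\<lambda>y. g' y b\<close>; for this the order of \<open>f\<close> is lowered from
      \<open>Suc k\<close> to \<open>k\<close>.\<close>
    have "Ck_on k S ((\<lambda>y. g' y b) \<circ> f)" for b
      using Suc.prems g' by (intro Suc.IH) (auto intro: Ck_on_Suc_imp simp del: Ck_on.simps)
    moreover have "Ck_on k S (\<lambda>x. f' x v \<bullet> b / (b \<bullet> b))" for b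
      using Ck_on_bounded_linear[OF lin f'(2)[rule_format]] .
    ultimately show "Ck_on k S (\<lambda>x. \<Sum>b\<in>C. (f' x v \<bullet> b / (b \<bullet> b)) *\<^sub>R g' (f x) b)"
      by (intro Ck_on_sum Ck_on_scaleR) (auto simp: o_def)
  next
    fix x assume "x \<in> S"
    then have "linear (g' (f x))"
      using g'(1) Suc.prems(3) by (blast intro: has_derivative_linear)
    then show "(\<Sum>b\<in>C. (f' x v \<bullet> b / (b \<bullet> b)) *\<^sub>R g' (f x) b) = g' (f x) (f' x v)"
      by (subst (2) C(2)[rule_format]) (simp add: linear_sum linear_cmul)
  qed
  with der show ?case
    unfolding Ck_on.simps by (intro exI[of _ "\<lambda>x v. g' (f x) (f' x v)"]) blast
qed

text \<open>On an open set derivatives are unique, so the existentially quantified \<open>f'\<close>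
  can be replaced by \<open>frechet_derivative\<close>. This choice does not depend on the set,
  which allows local statements to be glued.\<close>

lemma Ck_on_open_Suc_iff:
  assumes "open S"
  shows "Ck_on (Suc k) S f \<longleftrightarrow>
    (\<forall>x\<in>S. f differentiable (at x)) \<and> (\<forall>v. Ck_on k S (\<lambda>x. frechet_derivative f (at x) v))"
    (is "?L \<longleftrightarrow> ?R")
proof
  assume ?L
  then obtain f' where f': "\<forall>x\<in>S. (f has_derivative f' x) (at x)" "\<forall>v. Ck_on k S (\<lambda>x. f' x v)"
    using at_within_open[OF _ assms] by (metis Ck_on.simps(2))
  have "Ck_on k S (\<lambda>x. frechet_derivative f (at x) v)" for v
    by (rule Ck_on_cong[OF f'(2)[rule_format, of v]]) (metis f'(1) frechet_derivative_at)
  then show ?R using f'(1) differentiable_def by blast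
next
  assume ?R
  then show ?L
    by (auto intro!: exI[of _ "\<lambda>x. frechet_derivative f (at x)"]
        simp: frechet_derivative_works intro: has_derivative_at_withinI)
qed

text \<open>Local choices of derivative all coincide with \<open>frechet_derivative\<close>, so the
  induction can pass to that single function. The lemma is needed because a composition of smooth
  maps factors through an intermediate chart only locally.\<close>

lemma Ck_on_local:
  assumes "open S" "\<And>x. x \<in> S \<Longrightarrow> \<exists>N. open N \<and> x \<in> N \<and> Ck_on k (S \<inter> N) f"
  shows "Ck_on k S f"
  using assms(2)
proof (induction k arbitrary: f)
  case 0
  show ?case
    unfolding Ck_on.simps continuous_on_eq_continuous_at[OF assms(1)]
  proof
    fix x assume "x \<in> S"
    with 0 obtain N where "open N" "x \<in> N" "continuous_on (S \<inter> N) f" by auto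
    with \<open>x \<in> S\<close> show "isCont f x"
      using assms(1) continuous_on_eq_continuous_at[of "S \<inter> N" f] by auto
  qed
next
  case (Suc k)
  show ?case
    unfolding Ck_on_open_Suc_iff[OF assms(1)]
  proof (intro conjI ballI allI)
    fix x assume "x \<in> S"
    with Suc.prems obtain N where "open N" "x \<in> N" "Ck_on (Suc k) (S \<inter> N) f" by blast
    with \<open>x \<in> S\<close> show "f differentiable (at x)"
      using assms(1) Ck_on_open_Suc_iff[of "S \<inter> N" k f] by blast
  next
    fix v
    show "Ck_on k S (\<lambda>x. frechet_derivative f (at x) v)"
      using Suc.prems assms(1) Ck_on_open_Suc_iff[of "S \<inter> _" k f] by (intro Suc.IH) blast
  qed
qed

text \<open>The direction \<open>l v\<close> in the chain rule does not depend on the point, so the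
  induction hypothesis applies directly to \<open>\<lambda>y. f' y (l v)\<close> and no basis
  expansion enters. The intended use is the inclusion of a slice into a product chart.\<close>

lemma Ck_on_compose_affine:
  assumes "bounded_linear l"
  shows "Ck_on k T f \<Longrightarrow> (\<And>x. x \<in> S \<Longrightarrow> a + l x \<in> T) \<Longrightarrow> Ck_on k S (\<lambda>x. f (a + l x))"
proof (induction k arbitrary: f)
  case 0
  have "continuous_on S (\<lambda>x. a + l x)"
    by (intro continuous_intros bounded_linear.continuous_on[OF assms])
  with 0 show ?case
    by (auto intro!: continuous_on_compose2[of T f])
next
  case (Suc k)
  then obtain f' where f': "\<forall>x\<in>T. (f has_derivative f' x) (at x within T)"
    "\<forall>v. Ck_on k T (\<lambda>x. f' x v)" by auto
  have "((\<lambda>x. f (a + l x)) has_derivative (\<lambda>v. f' (a + l x) (l v))) (at x within S)"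
    if "x \<in> S" for x
  proof (rule has_derivative_in_compose2[where t = T and g = f and f = "\<lambda>x. a + l x"])
    show "((\<lambda>x. a + l x) has_derivative l) (at x within S)"
      using bounded_linear_imp_has_derivative[OF assms] by (auto intro!: derivative_eq_intros)
  qed (use f' Suc.prems that in auto)
  with f' Suc show ?case
    by (auto intro!: exI[of _ "\<lambda>x v. f' (a + l x) (l v)"])
qed

section \<open>Atlases and composition of smooth maps\<close>

lemma smooth_atlas_basis:
  fixes A :: "('m::topological_space, 'e::real_inner) chart set"
  assumes "smooth_atlas A"
  obtains B :: "'e set" where "finite B" "span B = UNIV"
  using assms unfolding smooth_atlas_def by blast

lemma smooth_atlas_chart:
  assumes "smooth_atlas A"
  obtains U \<psi> where "(U, \<psi>) \<in> A" "p \<in> U"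
  using assms unfolding smooth_atlas_def by blast

lemma smooth_atlas_open_inj:
  assumes "smooth_atlas A" "(U, \<psi>) \<in> A"
  shows "open U" "inj_on \<psi> U" "open W \<Longrightarrow> open (\<psi> ` (U \<inter> W))"
proof -
  have *: "open U" "open (\<psi> ` U)" "homeomorphism U (\<psi> ` U) \<psi> (inv_into U \<psi>)"
    using assms unfolding smooth_atlas_def is_chart_def by auto
  show "open U" by fact
  show "inj_on \<psi> U"
    using *(3) by (metis homeomorphism_def inj_on_inverseI)
  show "open (\<psi> ` (U \<inter> W))" if "open W"
    using homeomorphism_imp_open_map[OF *(3), of "U \<inter> W"] that *(2)
    by (simp add: openin_open_Int openin_open_eq)
qed

lemma smooth_mapD:
  assumes "smooth_map A B f" "(U, \<psi>) \<in> A" "(V, \<theta>) \<in> B"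
  shows "Ck_on k (\<psi> ` (U \<inter> f -` V)) (\<theta> \<circ> f \<circ> inv_into U \<psi>)"
  using assms unfolding smooth_map_def smooth_on_def by blast

lemma smooth_map_continuous: "smooth_map A B f \<Longrightarrow> continuous_on UNIV f"
  unfolding smooth_map_def by simp

text \<open>Near each point the coordinate expression of \<open>g \<circ> f\<close> factors through
  a chart of \<open>B\<close> around the image under \<open>f\<close>. Of \<open>C\<close> only open
  domains are asked, so that it can also be the single chart \<open>(UNIV, id)\<close> on the
  reals.\<close>

lemma smooth_map_compose:
  fixes A :: "('m::topological_space, 'e::real_inner) chart set"
    and B :: "('n::topological_space, 'f::real_inner) chart set"
    and C :: "('p::topological_space, 'g::real_inner) chart set"
  assumes A: "smooth_atlas A" and B: "smooth_atlas B" and C: "\<forall>(W, \<eta>)\<in>C. open W"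
    and f: "smooth_map A B f" and g: "smooth_map B C g"
  shows "smooth_map A C (g \<circ> f)"
proof -
  note cont = smooth_map_continuous[OF f] smooth_map_continuous[OF g]
  have cont_gf: "continuous_on UNIV (g \<circ> f)"
    using cont by (metis continuous_on_compose continuous_on_subset top_greatest)
  obtain E :: "'f set" where E: "finite E" "span E = UNIV"
    using smooth_atlas_basis[OF B] .
  have "Ck_on k (\<psi> ` (U \<inter> (g \<circ> f) -` W)) (\<eta> \<circ> (g \<circ> f) \<circ> inv_into U \<psi>)"
    if U: "(U, \<psi>) \<in> A" and W: "(W, \<eta>) \<in> C" for U \<psi> W \<eta> k
  proof (rule Ck_on_local)
    note inj = smooth_atlas_open_inj(2)[OF A U]
    have "open ((g \<circ> f) -` W)"
      using C W cont_gf by (auto intro: open_vimage)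
    then show "open (\<psi> ` (U \<inter> (g \<circ> f) -` W))"
      by (rule smooth_atlas_open_inj(3)[OF A U])
    fix z assume "z \<in> \<psi> ` (U \<inter> (g \<circ> f) -` W)"
    then obtain p where p: "p \<in> U" "g (f p) \<in> W" "z = \<psi> p" by auto
    obtain V \<theta> where V: "(V, \<theta>) \<in> B" "f p \<in> V"
      using smooth_atlas_chart[OF B] .
    note injV = smooth_atlas_open_inj(2)[OF B V(1)]
    \<comment> \<open>These are the coordinates of the points that \<open>f\<close> maps into
      \<open>V\<close>: the open neighbourhood of \<open>z\<close> on which the factorisation
      through \<open>\<theta>\<close> is valid.\<close>
    let ?N = "\<psi> ` (U \<inter> f -` V)"
    let ?S = "\<psi> ` (U \<inter> (g \<circ> f) -` W) \<inter> ?N"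
    have S: "?S = \<psi> ` (U \<inter> (g \<circ> f) -` W \<inter> (U \<inter> f -` V))"
      using inj by (intro inj_on_image_Int[symmetric]) auto
    have "Ck_on k ?S ((\<eta> \<circ> g \<circ> inv_into V \<theta>) \<circ> (\<theta> \<circ> f \<circ> inv_into U \<psi>))"
    proof (rule Ck_on_compose[OF E])
      show "Ck_on k ?S (\<theta> \<circ> f \<circ> inv_into U \<psi>)"
        using smooth_mapD[OF f U V(1)] by (rule Ck_on_subset) auto
      show "Ck_on k (\<theta> ` (V \<inter> g -` W)) (\<eta> \<circ> g \<circ> inv_into V \<theta>)"
        using smooth_mapD[OF g V(1) W] .
      show "(\<theta> \<circ> f \<circ> inv_into U \<psi>) ` ?S \<subseteq> \<theta> ` (V \<inter> g -` W)"
        unfolding S using inj by auto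
    qed
    then have "Ck_on k ?S (\<eta> \<circ> (g \<circ> f) \<circ> inv_into U \<psi>)"
      by (rule Ck_on_cong) (unfold S, use inj injV in auto)
    moreover have "open ?N"
      using smooth_atlas_open_inj(1)[OF B V(1)] cont(1)
      by (intro smooth_atlas_open_inj(3)[OF A U] open_vimage)
    ultimately show "\<exists>N. open N \<and> z \<in> N \<and> Ck_on k (\<psi> ` (U \<inter> (g \<circ> f) -` W) \<inter> N)
        (\<eta> \<circ> (g \<circ> f) \<circ> inv_into U \<psi>)"
      using p V(2) by blast
  qed
  with cont_gf show ?thesis
    unfolding smooth_map_def smooth_on_def by blast
qed

section \<open>The algebra of real-valued smooth functions\<close>

lemma smooth_functions_iff:
  "u \<in> smooth_functions A \<longleftrightarrow>
    continuous_on UNIV u \<and> (\<forall>(U, \<psi>)\<in>A. \<forall>k. Ck_on k (\<psi> ` U) (\<lambda>z. u (inv_into U \<psi> z)))"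
  unfolding smooth_functions_def smooth_map_def smooth_on_def by (auto simp: o_def)

lemma smooth_functions_add:
  "u \<in> smooth_functions A \<Longrightarrow> v \<in> smooth_functions A \<Longrightarrow> (\<lambda>x. u x + v x) \<in> smooth_functions A"
  unfolding smooth_functions_iff by (fastforce intro: continuous_on_add Ck_on_add)

lemma smooth_functions_mult:
  "u \<in> smooth_functions A \<Longrightarrow> v \<in> smooth_functions A \<Longrightarrow> (\<lambda>x. u x * v x) \<in> smooth_functions A"
  unfolding smooth_functions_iff real_scaleR_def[symmetric]
  by (fastforce intro: continuous_on_scaleR Ck_on_scaleR)

lemma smooth_functions_const: "(\<lambda>x. r) \<in> smooth_functions A"
  unfolding smooth_functions_iff by simp

lemma smooth_functions_compose:
  assumes "smooth_atlas A" "smooth_atlas B" "smooth_map A B f" "u \<in> smooth_functions B"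
  shows "u \<circ> f \<in> smooth_functions A"
  using assms smooth_map_compose[of A B "{(UNIV, id)}" f u] unfolding smooth_functions_def by auto

section \<open>Tangent lifts of curves\<close>

text \<open>In a chart around \<open>\<gamma> t\<close> the chain rule applies to
  \<open>u \<circ> inv_into U \<psi>\<close> after \<open>\<psi> \<circ> \<gamma>\<close>.\<close>

lemma C2_curve_has_vector_derivative:
  assumes A: "smooth_atlas A" and \<gamma>: "C2_curve A h \<gamma>" and t: "t \<in> {0..h}"
    and u: "u \<in> smooth_functions A"
  shows "\<exists>d. (u \<circ> \<gamma> has_vector_derivative d) (at t within {0..h})"
proof -
  obtain U \<psi> where U: "(U, \<psi>) \<in> A" "\<gamma> t \<in> U"
    using smooth_atlas_chart[OF A] .
  note inj = smooth_atlas_open_inj(2)[OF A U(1)]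
  define I where "I = {0..h} \<inter> \<gamma> -` U"
  have tI: "t \<in> I" using t U by (simp add: I_def)
  have "Ck_on (Suc 1) I (\<psi> \<circ> \<gamma>)"
    using \<gamma> U(1) unfolding C2_curve_def I_def by (auto simp: numeral_2_eq_2)
  then obtain \<gamma>' where \<gamma>': "(\<psi> \<circ> \<gamma> has_derivative \<gamma>') (at t within I)"
    using tI by auto
  have "Ck_on (Suc 0) (\<psi> ` U) (\<lambda>z. u (inv_into U \<psi> z))"
    using u U(1) unfolding smooth_functions_iff by blast
  then obtain u' where u':
    "((\<lambda>z. u (inv_into U \<psi> z)) has_derivative u') (at (\<psi> (\<gamma> t)) within \<psi> ` U)"
    using U(2) by auto
  have "((\<lambda>z. u (inv_into U \<psi> z)) has_derivative u') (at ((\<psi> \<circ> \<gamma>) t) within (\<psi> \<circ> \<gamma>) ` I)"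
    using u' by (auto simp: I_def intro: has_derivative_subset)
  from has_derivative_in_compose[OF \<gamma>' this]
  have "(u \<circ> \<gamma> has_derivative (\<lambda>x. u' (\<gamma>' x))) (at t within I)"
    by (rule has_derivative_transform[rotated 2]) (use tI inj in \<open>auto simp: I_def\<close>)
  \<comment> \<open>By continuity of \<open>\<gamma>\<close> the set \<open>I\<close> is relatively
    open in \<open>{0..h}\<close>, so a derivative within \<open>I\<close> is one within the whole
    interval, also at its end points.\<close>
  moreover obtain O' where "open O'" "I = {0..h} \<inter> O'"
  proof -
    have "openin (top_of_set {0..h}) I"
      unfolding I_def using \<gamma> smooth_atlas_open_inj(1)[OF A U(1)]
      by (auto simp: C2_curve_def intro: continuous_openin_preimage_gen)
    then show ?thesis using that by (auto simp: openin_open)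
  qed
  then have "at t within I = at t within {0..h}"
    using tI by (intro at_within_nhd[of t O']) auto
  ultimately have "u \<circ> \<gamma> differentiable (at t within {0..h})"
    unfolding differentiable_def by auto
  then show ?thesis
    using vector_derivative_works by blast
qed

text \<open>Since \<open>0 < h\<close> the interval is nondegenerate, so even the one-sided
  derivatives at its ends are unique.\<close>

lemma vector_derivative_within_unique:
  fixes f :: "real \<Rightarrow> 'a::real_normed_vector"
  assumes "0 < h" "t \<in> {0..h}" "(f has_vector_derivative d) (at t within {0..h})"
  shows "vector_derivative f (at t within {0..h}) = d"
  using vector_derivative_within_cbox[of 0 h t f d] assms by simp

text \<open>The derivation laws are the sum and product rules along the curve. Membership matters
  because \<open>invariant_lagrangian\<close> speaks only about elements of
  \<open>tangent_bundle A\<close>.\<close>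

lemma tangent_lift_in_tangent_bundle:
  assumes A: "smooth_atlas A" and h: "0 < h" and \<gamma>: "C2_curve A h \<gamma>" and t: "t \<in> {0..h}"
  shows "tangent_lift A h \<gamma> t \<in> tangent_bundle A"
proof -
  let ?d = "\<lambda>u. vector_derivative (u \<circ> \<gamma>) (at t within {0..h})"
  have d: "(u \<circ> \<gamma> has_vector_derivative ?d u) (at t within {0..h})" if "u \<in> smooth_functions A" for u
    using C2_curve_has_vector_derivative[OF A \<gamma> t that] vector_derivative_within_unique[OF h t] by blast
  have mult: "?d (\<lambda>x. u x * v x) = u (\<gamma> t) * ?d v + v (\<gamma> t) * ?d u"
    if "u \<in> smooth_functions A" "v \<in> smooth_functions A" for u v
    using has_vector_derivative_mult[OF d[OF that(1)] d[OF that(2)]]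
    by (intro vector_derivative_within_unique[OF h t]) (simp add: o_def mult.commute)
  have add: "?d (\<lambda>x. u x + v x) = ?d u + ?d v"
    if "u \<in> smooth_functions A" "v \<in> smooth_functions A" for u v
    using has_vector_derivative_add[OF d[OF that(1)] d[OF that(2)]]
    by (intro vector_derivative_within_unique[OF h t]) (simp add: o_def)
  have const: "vector_derivative (\<lambda>x. r) (at t within {0..h}) = 0" for r :: real
    by (intro vector_derivative_within_unique[OF h t]) simp
  \<comment> \<open>Homogeneity is the product rule with a constant factor, whose derivative is
    0.\<close>
  have scale: "?d (\<lambda>x. r * u x) = r * ?d u" if "u \<in> smooth_functions A" for r u
    using mult[OF smooth_functions_const[of r] that] by (simp add: const o_def)
  show ?thesis
    unfolding tangent_bundle_def tangent_lift_def
    using add mult scale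
    by (auto simp: smooth_functions_add smooth_functions_mult smooth_functions_const)
qed

text \<open>Both sides differentiate the same real function
  \<open>u \<circ> f \<circ> \<gamma>\<close>. Agreement of \<open>\<delta>\<close> with
  \<open>f \<circ> \<gamma>\<close> is asked only on \<open>{0..h}\<close>, which is all that
  equivariance gives.\<close>

lemma tangent_lift_compose:
  assumes "smooth_atlas A" "smooth_atlas B" "smooth_map A B f"
    and t: "t \<in> {0..h}" and eq: "\<And>r. r \<in> {0..h} \<Longrightarrow> \<delta> r = f (\<gamma> r)"
  shows "tangent_lift B h \<delta> t = tangent_map A B f (tangent_lift A h \<gamma> t)"
proof -
  have "vector_derivative (u \<circ> \<delta>) (at t within {0..h}) =
      vector_derivative ((u \<circ> f) \<circ> \<gamma>) (at t within {0..h})" for u :: "_ \<Rightarrow> real"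
    using t eq by (intro vector_derivative_cong_eq) (auto simp: eventually_at_filter)
  \<comment> \<open>As \<open>u \<circ> f\<close> is again smooth, the extensional derivation is
    evaluated where it is a derivative and not \<open>undefined\<close>.\<close>
  with assms show ?thesis
    by (auto simp: tangent_lift_def tangent_map_def smooth_functions_compose intro!: restrict_ext)
qed

section \<open>Transport of stationary points by smooth maps\<close>

text \<open>Differentiability of the coordinate expression \<open>F\<close> at the one point
  \<open>\<theta> p\<close> already bounds increments from that point linearly.\<close>

lemma smooth_map_local_lipschitz:
  assumes A: "smooth_atlas A" and B: "smooth_atlas B" and f: "smooth_map A B f"
    and V: "(V, \<theta>) \<in> A" "p \<in> V" and U: "(U, \<psi>) \<in> B" "f p \<in> U"
  shows "\<exists>K>0. \<exists>\<delta>>0. \<forall>q\<in>V. norm (\<theta> q - \<theta> p) < \<delta> \<longrightarrow>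
    f q \<in> U \<and> norm (\<psi> (f q) - \<psi> (f p)) \<le> K * norm (\<theta> q - \<theta> p)"
proof -
  note inj = smooth_atlas_open_inj(2)[OF A V(1)]
  define N where "N = \<theta> ` (V \<inter> f -` U)"
  define F where "F = \<psi> \<circ> f \<circ> inv_into V \<theta>"
  have "open N"
    unfolding N_def using smooth_atlas_open_inj(1)[OF B U(1)] smooth_map_continuous[OF f]
    by (intro smooth_atlas_open_inj(3)[OF A V(1)] open_vimage)
  moreover have pN: "\<theta> p \<in> N" using V U by (simp add: N_def)
  ultimately obtain d1 where d1: "0 < d1" "ball (\<theta> p) d1 \<subseteq> N"
    by (meson open_contains_ball)
  have "Ck_on (Suc 0) N F"
    using smooth_mapD[OF f V(1) U(1), of "Suc 0"] by (simp only: N_def F_def)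
  then obtain F' where F': "(F has_derivative F') (at (\<theta> p) within N)"
    using pN by auto
  obtain K where K: "0 < K" "\<And>v. norm (F' v) \<le> norm v * K"
    using has_derivative_bounded_linear[OF F'] bounded_linear.pos_bounded by blast
  \<comment> \<open>The definition of the derivative is used with error 1; together with the bound
    \<open>K\<close> on \<open>F'\<close> this gives the constant \<open>K + 1\<close>.\<close>
  obtain d2 where d2: "0 < d2"
    "\<And>z. z \<in> N \<Longrightarrow> norm (z - \<theta> p) < d2 \<Longrightarrow> norm (F z - F (\<theta> p) - F' (z - \<theta> p)) \<le> norm (z - \<theta> p)"
    using F' unfolding has_derivative_within_alt by (metis mult_1 zero_less_one)
  have "f q \<in> U \<and> norm (\<psi> (f q) - \<psi> (f p)) \<le> (K + 1) * norm (\<theta> q - \<theta> p)"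
    if q: "q \<in> V" "norm (\<theta> q - \<theta> p) < min d1 d2" for q
  proof -
    have qN: "\<theta> q \<in> N"
      using d1(2) q(2) by (auto simp: dist_norm norm_minus_commute)
    then have "f q \<in> U"
      using q(1) inj by (auto simp: N_def inj_on_def)
    have "norm (F (\<theta> q) - F (\<theta> p)) \<le>
        norm (F (\<theta> q) - F (\<theta> p) - F' (\<theta> q - \<theta> p)) + norm (F' (\<theta> q - \<theta> p))"
      using norm_triangle_sub by (metis add.commute)
    also have "\<dots> \<le> norm (\<theta> q - \<theta> p) + norm (\<theta> q - \<theta> p) * K"
      using d2(2)[OF qN] q(2) K(2) by (intro add_mono) auto
    finally show ?thesis
      using \<open>f q \<in> U\<close> q(1) V(2) inj by (simp add: F_def algebra_simps)
  qed
  then show ?thesis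
    using K(1) d1(1) d2(1) by (intro exI[of _ "K + 1"] conjI exI[of _ "min d1 d2"]) auto
qed

text \<open>The error bound for \<open>F'\<close> follows from the one for \<open>F\<close>, since \<open>k\<close> increases chart distances by at
  most a common factor \<open>C\<close>.\<close>

lemma stationary_at_transport:
  assumes A: "smooth_atlas A" and B: "smooth_atlas B" and k: "smooth_map B A k"
    and I: "finite I" and x: "\<And>i. i \<in> I \<Longrightarrow> x i = k (x' i)"
    and FF': "\<And>y. (\<And>i. i \<notin> I \<Longrightarrow> y i = x' i) \<Longrightarrow> F' y = F (\<lambda>i. if i \<in> I then k (y i) else x i)"
    and st: "stationary_at A I F x"
  shows "stationary_at B I F' x'"
  unfolding stationary_at_def
proof (intro allI impI)
  fix V \<theta> and \<epsilon> :: real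
  assume V: "\<forall>i\<in>I. (V i, \<theta> i) \<in> B \<and> x' i \<in> V i" and \<epsilon>: "0 < \<epsilon>"
  have "\<forall>i. \<exists>c. c \<in> A \<and> x i \<in> fst c"
    using smooth_atlas_chart[OF A] by (metis fst_conv)
  then obtain c where c: "\<And>i. c i \<in> A \<and> x i \<in> fst (c i)" by metis
  define U \<psi> where "U i = fst (c i)" and "\<psi> i = snd (c i)" for i
  have U: "(U i, \<psi> i) \<in> A" "x i \<in> U i" for i
    using c by (simp_all add: U_def \<psi>_def)
  define P where "P i K d \<longleftrightarrow> 0 < K \<and> 0 < d \<and> (\<forall>q\<in>V i. norm (\<theta> i q - \<theta> i (x' i)) < d \<longrightarrow>
      k q \<in> U i \<and> norm (\<psi> i (k q) - \<psi> i (x i)) \<le> K * norm (\<theta> i q - \<theta> i (x' i)))" for i K d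
  have "\<exists>K d. P i K d" if "i \<in> I" for i
  proof -
    have "(V i, \<theta> i) \<in> B" "x' i \<in> V i" "k (x' i) \<in> U i"
      using V U[of i] x that by auto
    from smooth_map_local_lipschitz[OF B A k this(1,2) U(1) this(3)] show ?thesis
      unfolding P_def x[OF that] by blast
  qed
  then obtain K d where "\<And>i. i \<in> I \<Longrightarrow> P i (K i) (d i)"
    by metis
  then have Kd: "\<And>i. i \<in> I \<Longrightarrow> 0 < K i \<and> 0 < d i"
    "\<And>i q. i \<in> I \<Longrightarrow> q \<in> V i \<Longrightarrow> norm (\<theta> i q - \<theta> i (x' i)) < d i \<Longrightarrow>
      k q \<in> U i \<and> norm (\<psi> i (k q) - \<psi> i (x i)) \<le> K i * norm (\<theta> i q - \<theta> i (x' i))"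
    unfolding P_def by blast+
  \<comment> \<open>The summand 1 in \<open>C\<close> and the element 1 in the minimum keep both
    constants positive when \<open>I\<close> is empty, which happens for
    \<open>s = 1\<close>.\<close>
  define C d0 where "C = 1 + (\<Sum>i\<in>I. K i)" and "d0 = Min (insert 1 (d ` I))"
  have K0: "0 \<le> K i" if "i \<in> I" for i
    using Kd(1)[OF that] by simp
  have "0 < C"
    using K0 unfolding C_def by (intro add_pos_nonneg sum_nonneg) auto
  moreover have "K i \<le> C" if "i \<in> I" for i
    using K0 I that unfolding C_def by (intro add_increasing member_le_sum) auto
  ultimately have C: "0 < C" "\<And>i. i \<in> I \<Longrightarrow> K i \<le> C"
    by blast+
  have d0: "0 < d0" "\<And>i. i \<in> I \<Longrightarrow> d0 \<le> d i"
    using Kd(1) I unfolding d0_def by auto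
  have "0 < \<epsilon> / C" using \<epsilon> C by simp
  with st[unfolded stationary_at_def, THEN spec, THEN spec, THEN mp, THEN spec, THEN mp, of U \<psi>] U
  have "\<exists>\<delta>>0. \<forall>y. (\<forall>i\<in>I. y i \<in> U i) \<and> (\<forall>i. i \<notin> I \<longrightarrow> y i = x i) \<and>
      (\<Sum>i\<in>I. norm (\<psi> i (y i) - \<psi> i (x i))) < \<delta> \<longrightarrow>
      \<bar>F y - F x\<bar> \<le> \<epsilon> / C * (\<Sum>i\<in>I. norm (\<psi> i (y i) - \<psi> i (x i)))"
    by blast
  then obtain \<delta> where \<delta>: "0 < \<delta>" "\<And>y. (\<forall>i\<in>I. y i \<in> U i) \<Longrightarrow> (\<forall>i. i \<notin> I \<longrightarrow> y i = x i) \<Longrightarrow>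
      (\<Sum>i\<in>I. norm (\<psi> i (y i) - \<psi> i (x i))) < \<delta> \<Longrightarrow>
      \<bar>F y - F x\<bar> \<le> \<epsilon> / C * (\<Sum>i\<in>I. norm (\<psi> i (y i) - \<psi> i (x i)))"
    by blast
  show "\<exists>\<delta>>0. \<forall>y. (\<forall>i\<in>I. y i \<in> V i) \<and> (\<forall>i. i \<notin> I \<longrightarrow> y i = x' i) \<and>
      (\<Sum>i\<in>I. norm (\<theta> i (y i) - \<theta> i (x' i))) < \<delta> \<longrightarrow>
      \<bar>F' y - F' x'\<bar> \<le> \<epsilon> * (\<Sum>i\<in>I. norm (\<theta> i (y i) - \<theta> i (x' i)))"
  \<comment> \<open>The bound \<open>d0\<close> keeps every coordinate where its Lipschitz estimate
    holds; \<open>\<delta> / C\<close> keeps the transported point within distance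
    \<open>\<delta>\<close> of \<open>x\<close>.\<close>
  proof (intro exI[of _ "min d0 (\<delta> / C)"] conjI allI impI)
    show "0 < min d0 (\<delta> / C)" using d0 \<delta> C by simp
    fix y
    let ?s = "\<Sum>i\<in>I. norm (\<theta> i (y i) - \<theta> i (x' i))"
    assume "(\<forall>i\<in>I. y i \<in> V i) \<and> (\<forall>i. i \<notin> I \<longrightarrow> y i = x' i) \<and> ?s < min d0 (\<delta> / C)"
    then have y: "\<And>i. i \<in> I \<Longrightarrow> y i \<in> V i" "\<And>i. i \<notin> I \<Longrightarrow> y i = x' i"
      and s: "?s < d0" "C * ?s < \<delta>"
      using C by (auto simp: field_simps)
    define z where "z i = (if i \<in> I then k (y i) else x i)" for i
    let ?S = "\<Sum>i\<in>I. norm (\<psi> i (z i) - \<psi> i (x i))"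
    have z: "z i \<in> U i \<and> norm (\<psi> i (z i) - \<psi> i (x i)) \<le> C * norm (\<theta> i (y i) - \<theta> i (x' i))"
      if i: "i \<in> I" for i
    proof -
      have "norm (\<theta> i (y i) - \<theta> i (x' i)) \<le> ?s"
        using i I by (intro member_le_sum) auto
      then have "norm (\<theta> i (y i) - \<theta> i (x' i)) < d i"
        using s(1) d0(2)[OF i] by linarith
      from Kd(2)[OF i y(1)[OF i] this] show ?thesis
        using order_trans[OF _ mult_right_mono[OF C(2)[OF i] norm_ge_zero]] i by (auto simp: z_def)
    qed
    have le: "?S \<le> C * ?s"
      unfolding sum_distrib_left using z by (intro sum_mono) auto
    have "F' y = F z" using FF'[of y] y(2) by (simp add: z_def[abs_def])
    moreover have "F' x' = F x"
      using FF'[of x'] x by (auto intro!: arg_cong[of _ _ F])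
    moreover have "\<bar>F z - F x\<bar> \<le> \<epsilon> / C * ?S"
      using z le s(2) by (intro \<delta>(2)) (auto simp: z_def)
    moreover have "\<epsilon> / C * ?S \<le> \<epsilon> / C * (C * ?s)"
      using le \<epsilon> C by (intro mult_left_mono) auto
    ultimately show "\<bar>F' y - F' x'\<bar> \<le> \<epsilon> * ?s"
      using C(1) by simp
  qed
qed

section \<open>Left translations and invariance of the discrete action\<close>

context lie_group
begin

text \<open>Multiplication is smooth in product charts, and freezing its first argument at
  \<open>g\<close> restricts it to the slice through \<open>\<eta> g\<close>.\<close>

lemma smooth_left_translation: "smooth_map A A (gmult g)"
proof -
  note cont = smooth_map_continuous[OF smooth_mult]
  have cont_g: "continuous_on UNIV (gmult g)"
    using continuous_on_compose2[OF cont, of UNIV "\<lambda>x. (g, x)"]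
      continuous_on_Pair[OF continuous_on_const continuous_on_id, of UNIV g] by simp
  obtain W \<eta> where W: "(W, \<eta>) \<in> A" "g \<in> W"
    using smooth_atlas_chart[OF atlas] .
  note injW = smooth_atlas_open_inj(2)[OF atlas W(1)]
  have "Ck_on k (\<psi> ` (U \<inter> gmult g -` V)) (\<theta> \<circ> gmult g \<circ> inv_into U \<psi>)"
    if U: "(U, \<psi>) \<in> A" and V: "(V, \<theta>) \<in> A" for U \<psi> V \<theta> k
  proof -
    note injU = smooth_atlas_open_inj(2)[OF atlas U]
    have inj: "inj_on (map_prod \<eta> \<psi>) (W \<times> U)"
      using injW injU by (rule map_prod_inj_on)
    let ?m = "\<lambda>(x, y). gmult x y"
    have "(W \<times> U, map_prod \<eta> \<psi>) \<in> product_atlas A A"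
      using W U unfolding product_atlas_def by blast
    from smooth_mapD[OF smooth_mult this V]
    have "Ck_on k (map_prod \<eta> \<psi> ` ((W \<times> U) \<inter> ?m -` V)) (\<theta> \<circ> ?m \<circ> inv_into (W \<times> U) (map_prod \<eta> \<psi>))" .
    \<comment> \<open>The slice inclusion \<open>z \<mapsto> (\<eta> g, z)\<close> is written as a
      constant plus a bounded linear map to fit \<open>Ck_on_compose_affine\<close>.\<close>
    then have "Ck_on k (\<psi> ` (U \<inter> gmult g -` V))
        (\<lambda>z. (\<theta> \<circ> ?m \<circ> inv_into (W \<times> U) (map_prod \<eta> \<psi>)) ((\<eta> g, 0) + (0, z)))"
      by (rule Ck_on_compose_affine[rotated])
        (use W in \<open>force intro!: bounded_linear_Pair bounded_linear_zero bounded_linear_ident\<close>)+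
    then show ?thesis
    proof (rule Ck_on_cong)
      fix z assume "z \<in> \<psi> ` (U \<inter> gmult g -` V)"
      then obtain q where q: "q \<in> U" "z = \<psi> q" by auto
      have "inv_into (W \<times> U) (map_prod \<eta> \<psi>) (\<eta> g, \<psi> q) = (g, q)"
        using inv_into_f_f[OF inj, of "(g, q)"] q W(2) by simp
      then show "(\<theta> \<circ> ?m \<circ> inv_into (W \<times> U) (map_prod \<eta> \<psi>)) ((\<eta> g, 0) + (0, z)) =
          (\<theta> \<circ> gmult g \<circ> inv_into U \<psi>) z"
        using q injU by simp
    qed
  qed
  with cont_g show ?thesis
    unfolding smooth_map_def smooth_on_def by blast
qed

lemma discrete_action_invariant:
  assumes h: "0 < h" and c: "\<forall>i\<in>{1..s}. c i \<in> {0..1}" and int: "interpolatory A s h \<phi>"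
    and eq: "equivariant gmult s h \<phi>" and L: "invariant_lagrangian gmult A L" and x: "x \<in> tuples s"
  shows "discrete_action A s h b c \<phi> L (\<lambda>\<nu>\<in>{0..s}. gmult g (x \<nu>)) = discrete_action A s h b c \<phi> L x"
proof -
  have "L (tangent_lift A h (\<phi> (\<lambda>\<nu>\<in>{0..s}. gmult g (x \<nu>))) (c i * h)) =
      L (tangent_lift A h (\<phi> x) (c i * h))" if "i \<in> {1..s}" for i
  proof -
    have t: "c i * h \<in> {0..h}"
      using c that h by (auto simp: mult_left_le_one_le)
    have "tangent_lift A h (\<phi> (\<lambda>\<nu>\<in>{0..s}. gmult g (x \<nu>))) (c i * h) =
        tangent_map A A (gmult g) (tangent_lift A h (\<phi> x) (c i * h))"
      using eq x unfolding equivariant_def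
      by (intro tangent_lift_compose atlas smooth_left_translation t) auto
    moreover have "tangent_lift A h (\<phi> x) (c i * h) \<in> tangent_bundle A"
      using int x unfolding interpolatory_def
      by (intro tangent_lift_in_tangent_bundle atlas h t) auto
    ultimately show ?thesis
      using L unfolding invariant_lagrangian_def by simp
  qed
  then show ?thesis
    unfolding discrete_action_def by (intro arg_cong[of _ _ "(*) h"] sum.cong) auto
qed

lemma stationary_values_translate:
  assumes s: "1 \<le> s"
    and F: "\<And>g x. x \<in> tuples s \<Longrightarrow> F (\<lambda>\<nu>\<in>{0..s}. gmult g (x \<nu>)) = F x"
  shows "stationary_values A s F g0 g1 \<subseteq> stationary_values A s F (gmult g g0) (gmult g g1)"
proof
  fix r assume "r \<in> stationary_values A s F g0 g1"
  then obtain x where x: "x \<in> tuples s" "x 0 = g0" "x s = g1" "stationary_at A {1..<s} F x"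
    and r: "r = F x"
    unfolding stationary_values_def by auto
  define x' where "x' = (\<lambda>\<nu>\<in>{0..s}. gmult g (x \<nu>))"
  have cancel: "gmult (ginv g) (gmult g p) = p" for p
    by (simp add: assoc[symmetric] group_left_neutral)
  have "stationary_at A {1..<s} F x'"
  \<comment> \<open>The transporting map is translation by \<open>ginv g\<close>, since it must lead
    from the new point \<open>x'\<close> back to the stationary point \<open>x\<close>.\<close>
  proof (rule stationary_at_transport[OF atlas atlas smooth_left_translation _ _ _ x(4)])
    show "x i = gmult (ginv g) (x' i)" if "i \<in> {1..<s}" for i
      using that by (simp add: x'_def cancel)
    fix y assume y: "\<And>i. i \<notin> {1..<s} \<Longrightarrow> y i = x' i"
    have yt: "y \<in> tuples s"
      using y by (auto simp: PiE_def extensional_def x'_def)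
    \<comment> \<open>Stationarity varies only the inner points. At the end indices 0 and
      \<open>s\<close>, \<open>y\<close> equals \<open>x'\<close>, so translating back gives
      \<open>x\<close> there, and the mixed tuple is the translate of all of \<open>y\<close>;
      outside \<open>{0..s}\<close> both sides are \<open>undefined\<close>.\<close>
    have "(\<lambda>i. if i \<in> {1..<s} then gmult (ginv g) (y i) else x i) =
        (\<lambda>\<nu>\<in>{0..s}. gmult (ginv g) (y \<nu>))"
      using y x(1) by (auto simp: fun_eq_iff x'_def cancel PiE_def extensional_def)
    then show "F y = F (\<lambda>i. if i \<in> {1..<s} then gmult (ginv g) (y i) else x i)"
      using F[OF yt] by simp
  qed simp
  moreover have "x' \<in> tuples s" "x' 0 = gmult g g0" "x' s = gmult g g1" "F x' = r"
    using x r F[OF x(1)] by (auto simp: x'_def)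
  ultimately show "r \<in> stationary_values A s F (gmult g g0) (gmult g g1)"
    unfolding stationary_values_def by blast
qed

end

theorem proposition1:
  fixes gmult :: "'g::{t2_space, second_countable_topology} \<Rightarrow> 'g \<Rightarrow> 'g"
    and gone :: 'g and ginv :: "'g \<Rightarrow> 'g"
    and A :: "('g, 'e::real_inner) chart set"
    and s :: nat and h :: real and b c :: "nat \<Rightarrow> real"
    and \<phi> :: "(nat \<Rightarrow> 'g) \<Rightarrow> real \<Rightarrow> 'g"
    and L :: "'g tangent \<Rightarrow> real"
  assumes "lie_group gmult gone ginv A"
    and "1 \<le> s" and "0 < h"
    and "\<forall>i\<in>{1..s}. c i \<in> {0..1}"
    and "interpolatory A s h \<phi>"
    and "ext_well_defined A s h b c \<phi> L"
    and "equivariant gmult s h \<phi>"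
    and "invariant_lagrangian gmult A L"
  shows "\<forall>g g0 g1. discrete_lagrangian A s h b c \<phi> L (gmult g g0) (gmult g g1) =
           discrete_lagrangian A s h b c \<phi> L g0 g1"
proof (intro allI)
  fix g g0 g1
  interpret lie_group gmult gone ginv A by fact
  let ?F = "discrete_action A s h b c \<phi> L"
  have "stationary_values A s ?F g0 g1 \<subseteq> stationary_values A s ?F (gmult g g0) (gmult g g1)"
    using assms by (intro stationary_values_translate discrete_action_invariant) auto
  moreover have "is_singleton (stationary_values A s ?F p q)" for p q
    using assms(6) unfolding ext_well_defined_def by blast
  \<comment> \<open>A singleton contained in a singleton equals it, so one inclusion
    suffices.\<close>
  ultimately have "stationary_values A s ?F g0 g1 = stationary_values A s ?F (gmult g g0) (gmult g g1)"
    by (metis is_singleton_def subset_singleton_iff insert_not_empty)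
  then show "discrete_lagrangian A s h b c \<phi> L (gmult g g0) (gmult g g1) =
      discrete_lagrangian A s h b c \<phi> L g0 g1"
    by (simp add: discrete_lagrangian_def)
qed

end
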